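(* Let $\mathcal{H}$ be a hypergraph with $n=|V(\mathcal{H})|$ vertices and set $$t=\max\left\{|V(\mathcal{H})|-\operatorname{alt}(\mathcal{H}),\ |V(\mathcal{H})|-\operatorname{salt}(\mathcal{H})+1\right\}.$$ Then for any proper coloring $c:V(\operatorname{KG}(\mathcal{H}))\to[C]$ there exists a complete bipartite subgraph $K_{\lfloor t/2\rfloor,\lceil t/2\rceil}$ of $\operatorname{KG}(\mathcal{H})$ all of whose $t$ vertices receive pairwise different colors, and moreover these colors occur alternating on the two parts with respect to their natural order: if the colors are $i_1<i_2<\cdots<i_t$, then one part receives exactly the colors $\{i_j : j\in[t] \text{ odd}\}$ and the other part exactly the colors $\{i_j: j\in[t]\text{ even}\}$.
   Context: $[n]=\{1,\dots,n\}$. For a hypergraph $\mathcal{H}=(V,E)$, the general Kneser graph $\operatorname{KG}(\mathcal{H})$ has vertex set $E$, two vertices adjacent iff the corresponding edges are disjoint. For $X=(x_1,\dots,x_n)\in\{-,0,+\}^n$, an alternating subsequence of length $m$ is a sequence $x_{i_1},\dots,x_{i_m}$ with $i_1<\dots<i_m$, all $x_{i_j}\neq 0$, and $x_{i_j}\neq x_{i_{j+1}}$; $\operatorname{alt}(X)$ is the maximum length of an alternating subsequence ($\operatorname{alt}(\mathbf 0)=0$). Let $X^+=\{i: x_i=+\}$, $X^-=\{i:x_i=-\}$. For a bijection $\sigma:[n]\to V(\mathcal{H})$, $\operatorname{alt}_\sigma(\mathcal{H})$ is the maximum of $\operatorname{alt}(X)$ over $X\in\{-,0,+\}^n$ such that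 neither $\sigma(X^+)$ nor $\sigma(X^-)$ contains an edge of $\mathcal{H}$; $\operatorname{salt}_\sigma(\mathcal{H})$ is the maximum of $\operatorname{alt}(X)$ over $X$ such that $\sigma(X^+)$ contains no edge of $\mathcal{H}$ or $\sigma(X^-)$ contains no edge of $\mathcal{H}$. Then $\operatorname{alt}(\mathcal{H})=\min_\sigma \operatorname{alt}_\sigma(\mathcal{H})$ and $\operatorname{salt}(\mathcal{H})=\min_\sigma\operatorname{salt}_\sigma(\mathcal{H})$, minima over all bijections $\sigma:[n]\to V(\mathcal{H})$.
   Formalization: The hypergraph is assumed to have at least one edge: for an edgeless hypergraph alt = salt = n, so t = 1, but the Kneser graph has no vertices and contains no K_{0,1}. *)

theory Defs
  imports
    Main
    "HOL-Library.Sublist"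
    "Graph_Theory.Digraph_Component"
    "Graph_Theory.Kuratowski"
begin

definition hypergraph :: "'a set \<Rightarrow> 'a set set \<Rightarrow> bool" where
  "hypergraph V E \<longleftrightarrow> finite V \<and> E \<subseteq> Pow V"

text \<open>As in \<^theory>\<open>Graph_Theory.Digraph\<close>, an undirected graph is a symmetric digraph.
  Adjacency is disjointness without a distinctness condition. Two equal edges are disjoint only
  if they are empty, so the graph is loop-free unless the empty set is an edge, in which case it
  has no proper colouring.\<close>

definition KG :: "'a set set \<Rightarrow> 'a set pair_pre_digraph" where
  "KG E = \<lparr> pverts = E, parcs = {(e, f). e \<in> E \<and> f \<in> E \<and> e \<inter> f = {}} \<rparr>"

definition proper_coloring :: "('a, 'b) pre_digraph \<Rightarrow> ('a \<Rightarrow> 'c) \<Rightarrow> 'c set \<Rightarrow> bool" where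
  "proper_coloring G c S \<longleftrightarrow>
     c ` verts G \<subseteq> S \<and> (\<forall>(u, v) \<in> arcs_ends G. c u \<noteq> c v)"

text \<open>This is \<^const>\<open>complete_bipartite_digraph\<close> with the two parts made explicit; see the
  lemma below.\<close>

definition complete_bipartite_parts ::
    "nat \<Rightarrow> nat \<Rightarrow> 'a set \<Rightarrow> 'a set \<Rightarrow> ('a, 'b) pre_digraph \<Rightarrow> bool" where
  "complete_bipartite_parts m n A B G \<longleftrightarrow>
     graph G \<and> verts G = A \<union> B \<and> A \<inter> B = {} \<and> card A = m \<and> card B = n \<and>
     arcs_ends G = A \<times> B \<union> B \<times> A"

lemma complete_bipartite_digraph_iff_parts:
  "complete_bipartite_digraph m n G \<longleftrightarrow> (\<exists>A B. complete_bipartite_parts m n A B G)"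
  by (auto simp: complete_bipartite_digraph_def complete_bipartite_parts_def)

datatype sign = Minus | Zero | Plus

text \<open>A vector in $\{-,0,+\}^n$ is a list of length $n$. Its coordinates, and hence the orderings
  of the vertex set, are indexed by $\{0,\dots,n-1\}$ instead of $\{1,\dots,n\}$.\<close>

definition sign_vectors :: "nat \<Rightarrow> sign list set" where
  "sign_vectors n = {X. length X = n}"

definition pos :: "sign list \<Rightarrow> nat set" where
  "pos X = {i. i < length X \<and> X ! i = Plus}"

definition neg :: "sign list \<Rightarrow> nat set" where
  "neg X = {i. i < length X \<and> X ! i = Minus}"

definition alternating :: "sign list \<Rightarrow> bool" where
  "alternating xs \<longleftrightarrow> Zero \<notin> set xs \<and> successively (\<noteq>) xs"

definition alt_vec :: "sign list \<Rightarrow> nat" where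
  "alt_vec X = Max {length xs | xs. subseq xs X \<and> alternating xs}"

definition contains_edge :: "'a set set \<Rightarrow> 'a set \<Rightarrow> bool" where
  "contains_edge E S \<longleftrightarrow> (\<exists>e\<in>E. e \<subseteq> S)"

definition orderings :: "'a set \<Rightarrow> (nat \<Rightarrow> 'a) set" where
  "orderings V = {\<sigma>. bij_betw \<sigma> {..<card V} V}"

text \<open>If the empty set is an edge, the sets under \<^const>\<open>Max\<close> in the next two definitions are
  empty and the values are unspecified; otherwise the zero vector belongs to both.\<close>

definition alt_ord :: "'a set \<Rightarrow> 'a set set \<Rightarrow> (nat \<Rightarrow> 'a) \<Rightarrow> nat" where
  "alt_ord V E \<sigma> = Max (alt_vec ` {X \<in> sign_vectors (card V).
     \<not> contains_edge E (\<sigma> ` pos X) \<and> \<not> contains_edge E (\<sigma> ` neg X)})"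

definition salt_ord :: "'a set \<Rightarrow> 'a set set \<Rightarrow> (nat \<Rightarrow> 'a) \<Rightarrow> nat" where
  "salt_ord V E \<sigma> = Max (alt_vec ` {X \<in> sign_vectors (card V).
     \<not> contains_edge E (\<sigma> ` pos X) \<or> \<not> contains_edge E (\<sigma> ` neg X)})"

definition alt :: "'a set \<Rightarrow> 'a set set \<Rightarrow> nat" where
  "alt V E = Min (alt_ord V E ` orderings V)"

definition salt :: "'a set \<Rightarrow> 'a set set \<Rightarrow> nat" where
  "salt V E = Min (salt_ord V E ` orderings V)"

text \<open>The maxima and minima above range over finite sets, and \<^const>\<open>alt\<close> and \<^const>\<open>salt\<close> never
  exceed the number of vertices, so subtracting them from it in \<^typ>\<open>nat\<close> does not truncate.\<close>

lemma finite_sign_vectors: "finite (sign_vectors n)"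
proof -
  have "(UNIV :: sign set) = {Minus, Zero, Plus}" using sign.exhaust by blast
  then have "finite (UNIV :: sign set)" by (metis finite.emptyI finite.insertI)
  from finite_lists_length_eq[OF this, of n] show ?thesis by (simp add: sign_vectors_def)
qed

lemma finite_alternating_lengths: "finite {length xs | xs. subseq xs X \<and> alternating xs}"
  by (rule finite_subset[of _ "{..length X}"]) (auto dest: list_emb_length)

lemma zero_alternating_length: "0 \<in> {length xs | xs. subseq xs X \<and> alternating xs}"
  by (auto simp: alternating_def intro!: exI[of _ "[]"])

lemma alt_vec_le_length: "alt_vec X \<le> length X"
proof -
  have "alt_vec X \<in> {length xs | xs. subseq xs X \<and> alternating xs}"
    unfolding alt_vec_def
    by (rule Max_in[OF finite_alternating_lengths]) (use zero_alternating_length in blast)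
  then show ?thesis by (auto dest: list_emb_length)
qed

lemma zero_vector_edge_free:
  assumes "{} \<notin> E"
  shows "replicate n Zero \<in> {X \<in> sign_vectors n.
           \<not> contains_edge E (\<sigma> ` pos X) \<and> \<not> contains_edge E (\<sigma> ` neg X)}"
proof -
  have "pos (replicate n Zero) = {}" "neg (replicate n Zero) = {}"
    by (auto simp: pos_def neg_def)
  with assms show ?thesis by (auto simp: contains_edge_def sign_vectors_def)
qed

lemma Max_alt_vec_le:
  assumes "S \<subseteq> sign_vectors n" and "S \<noteq> {}"
  shows "Max (alt_vec ` S) \<le> n"
proof -
  have "finite S" using assms(1) finite_sign_vectors by (rule finite_subset)
  moreover have "alt_vec X \<le> n" if "X \<in> S" for X
    using that assms(1) alt_vec_le_length[of X] by (auto simp: sign_vectors_def)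
  ultimately show ?thesis using assms(2) by (auto intro: Max.boundedI)
qed

lemma alt_ord_le: "{} \<notin> E \<Longrightarrow> alt_ord V E \<sigma> \<le> card V"
  unfolding alt_ord_def using zero_vector_edge_free[of E "card V" \<sigma>]
  by (intro Max_alt_vec_le) blast+

lemma salt_ord_le: "{} \<notin> E \<Longrightarrow> salt_ord V E \<sigma> \<le> card V"
  unfolding salt_ord_def using zero_vector_edge_free[of E "card V" \<sigma>]
  by (intro Max_alt_vec_le) blast+

lemma orderings_nonempty: "finite V \<Longrightarrow> orderings V \<noteq> {}"
  using ex_bij_betw_nat_finite[of V] by (auto simp: orderings_def atLeast0LessThan)

lemma finite_alt_ord_image: "{} \<notin> E \<Longrightarrow> finite (alt_ord V E ` orderings V)"
  by (rule finite_subset[of _ "{..card V}"]) (auto simp: alt_ord_le)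

lemma finite_salt_ord_image: "{} \<notin> E \<Longrightarrow> finite (salt_ord V E ` orderings V)"
  by (rule finite_subset[of _ "{..card V}"]) (auto simp: salt_ord_le)

lemma alt_le: "finite V \<Longrightarrow> {} \<notin> E \<Longrightarrow> alt V E \<le> card V"
  unfolding alt_def using orderings_nonempty[of V]
  by (subst Min_le_iff) (auto simp: finite_alt_ord_image alt_ord_le)

lemma salt_le: "finite V \<Longrightarrow> {} \<notin> E \<Longrightarrow> salt V E \<le> card V"
  unfolding salt_def using orderings_nonempty[of V]
  by (subst Min_le_iff) (auto simp: finite_salt_ord_image salt_ord_le)

end

theory Submission
  imports Defs
begin

text \<open>The theorem is read off Ky Fan's lemma. Fix an ordering attaining the alternation number
  \<open>k\<close>. A nonzero sign vector $X$ is labelled by $\pm\mathrm{alt}(X)$, signed by its first nonzero entry, if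
  $\mathrm{alt}(X) \le k$, and otherwise by $\pm(k + {}$the largest colour of an edge inside $X^+$ or $X^-)$,
  signed by the side containing that edge. This labelling is antipodal and comparable vectors never
  have opposite labels, so some maximal chain has $n$ labels of strictly increasing absolute value and
  alternating sign. At least $n-k$ of these labels come from edges, and edges belonging to opposite
  signs are disjoint. With the strong alternation number, both sides of every vector of the chain
  labelled by a colour contain an edge; the one on the other side of the smallest such vector
  supplies one more, smaller colour.

  Ky Fan's lemma is proved by parity: the number of maximal chains with alternating labels does not
  change from one dimension to the next, by double counting the chains of a hemisphere with one
  member deleted whose labels alternate.\<close>

text \<open>The orbits of \<open>h\<close> are pairs, and each induction step removes one. It serves
  to cancel the interior faces of a hemisphere, each of which is counted from both adjacent maximal
  chains.\<close>

lemma even_card_involution: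
  assumes "finite S"
    and "\<And>x. x \<in> S \<Longrightarrow> h x \<in> S" "\<And>x. x \<in> S \<Longrightarrow> h (h x) = x" "\<And>x. x \<in> S \<Longrightarrow> h x \<noteq> x"
  shows "even (card S)"
  using assms
proof (induction S rule: finite_psubset_induct)
  case (psubset S)
  show ?case
  proof (cases "S = {}")
    case False
    then obtain x where x: "x \<in> S" by blast
    let ?T = "S - {x, h x}"
    have "h y \<in> ?T" if "y \<in> ?T" for y
      using that psubset.prems x by (metis Diff_iff insert_iff singletonD)
    with x psubset.prems have "even (card ?T)"
      by (intro psubset.IH) auto
    moreover have "card S = card ?T + 2"
      using x psubset.prems psubset.hyps
      by (metis card_Diff_subset card_2_iff card_mono empty_subsetI finite.intros insert_subset
          le_add_diff_inverse2)
    ultimately show ?thesis by simp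
  qed simp
qed

subsection \<open>Alternating sign patterns\<close>

fun alternating_from :: "bool \<Rightarrow> bool list \<Rightarrow> bool" where
  "alternating_from b [] = True"
| "alternating_from b (x # xs) \<longleftrightarrow> x = b \<and> alternating_from (\<not> b) xs"

lemma alternating_from_nth:
  "alternating_from b xs \<Longrightarrow> i < length xs \<Longrightarrow> xs ! i \<longleftrightarrow> b \<noteq> odd i"
  by (induction b xs arbitrary: i rule: alternating_from.induct)
    (auto simp: nth_Cons split: nat.splits)

lemma alternating_from_map_Not:
  "alternating_from b (map Not xs) \<longleftrightarrow> alternating_from (\<not> b) xs"
  by (induction xs arbitrary: b) auto

lemma alternating_from_unique:
  "alternating_from True xs \<Longrightarrow> alternating_from False xs \<Longrightarrow> xs = []"
  by (cases xs) auto

text \<open>In a nonempty word alternating from \<open>b\<close> only the last letter can be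
  deleted, in one alternating from \<open>\<not> b\<close> only the first; any other word admits no
  such deletion or two, namely of either letter of its only pair of equal neighbours. The induction
  avoids this analysis: deleting the head leaves the tail, and every other deletion keeps the head,
  which then has to be \<open>b\<close>.\<close>

lemma parity_alternating_deletions:
  assumes "distinct xs"
  shows "even (card {i \<in> set xs. alternating_from b (map g (filter (\<lambda>j. j \<noteq> i) xs))}) \<longleftrightarrow>
    (alternating_from b (map g xs) \<longleftrightarrow> alternating_from (\<not> b) (map g xs))"
  using assms
proof (induction xs arbitrary: b)
  case (Cons x xs)
  let ?D = "\<lambda>b xs. {i \<in> set xs. alternating_from b (map g (filter (\<lambda>j. j \<noteq> i) xs))}"
  have x: "filter (\<lambda>j. j \<noteq> x) xs = xs" and ne: "\<And>i. i \<in> set xs \<Longrightarrow> x \<noteq> i"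
    using Cons.prems by (auto simp: filter_id_conv)
  have "?D b (x # xs) = (if alternating_from b (map g xs) then {x} else {}) \<union>
      (if g x = b then ?D (\<not> b) xs else {})"
    using x ne by auto
  moreover have "x \<notin> ?D (\<not> b) xs" using Cons.prems by simp
  ultimately have "card (?D b (x # xs)) = of_bool (alternating_from b (map g xs)) +
      (if g x = b then card (?D (\<not> b) xs) else 0)"
    by auto
  with Cons.IH[of "\<not> b"] Cons.prems show ?case by auto
qed simp

text \<open>The values of \<open>f\<close> stand for signed labels whose sign is their parity, odd
  being positive; the encoding is explained at \<open>opposite\<close> below. Equal labels become
  neighbours in the sorted list and violate alternation, so the labels are also pairwise
  distinct.\<close>

definition sorted_alternating :: "bool \<Rightarrow> ('i \<Rightarrow> nat) \<Rightarrow> 'i list \<Rightarrow> bool" where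
  "sorted_alternating b f xs \<longleftrightarrow> alternating_from b (map (odd \<circ> f) (sort_key f xs))"

text \<open>Insertion sort uses its keys only in comparisons.\<close>

lemma sort_key_cong_order:
  assumes "\<And>x y. x \<in> set xs \<Longrightarrow> y \<in> set xs \<Longrightarrow> f x \<le> f y \<longleftrightarrow> g x \<le> g y"
  shows "sort_key f xs = sort_key g xs"
  using assms
proof (induction xs)
  case (Cons x xs)
  have "insort_key f x ys = insort_key g x ys" if "set ys \<subseteq> set xs" for ys
    using that Cons.prems by (induction ys) auto
  with Cons show ?case by simp
qed simp

lemma sorted_alternating_cong:
  assumes "\<And>x. x \<in> set xs \<Longrightarrow> f x = g x"
  shows "sorted_alternating b f xs \<longleftrightarrow> sorted_alternating b g xs"
proof -
  have "sort_key f xs = sort_key g xs" using assms by (intro sort_key_cong_order) auto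
  moreover have "map (odd \<circ> f) (sort_key g xs) = map (odd \<circ> g) (sort_key g xs)"
    using assms by (intro map_cong) auto
  ultimately show ?thesis by (simp only: sorted_alternating_def)
qed

text \<open>Sorting commutes with the deletion of an index, so the count for words applies to the
  sorted list.\<close>

lemma parity_sorted_alternating_deletions:
  assumes "distinct xs"
  shows "even (card {i \<in> set xs. sorted_alternating b f (filter (\<lambda>j. j \<noteq> i) xs)}) \<longleftrightarrow>
    (sorted_alternating b f xs \<longleftrightarrow> sorted_alternating (\<not> b) f xs)"
  using parity_alternating_deletions[of "sort_key f xs" b "odd \<circ> f"] assms
  by (simp add: sorted_alternating_def filter_sort)

text \<open>The signed labels $+m$ and $-m$ are encoded as the numbers $2m+1$ and $2m$. Sorting by
  absolute value is then sorting by the usual order as long as no two labels are opposite.\<close>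

definition opposite :: "nat \<Rightarrow> nat" where
  "opposite m = (if even m then m + 1 else m - 1)"

lemma odd_opposite [simp]: "odd (opposite m) \<longleftrightarrow> even m"
  by (auto simp: opposite_def)

lemma opposite_opposite [simp]: "opposite (opposite m) = m"
  by (auto simp: opposite_def)

lemma opposite_encode [simp]: "opposite (2 * m + of_bool b) = 2 * m + of_bool (\<not> b)"
  by (simp add: opposite_def)

text \<open>\<open>opposite\<close> exchanges \<open>2 * m\<close> and \<open>2 * m + 1\<close>, so
  it can reverse the order only between the two numbers of such a pair, which the assumptions
  exclude.\<close>

lemma opposite_le_iff:
  assumes "x \<noteq> opposite y" "y \<noteq> opposite x"
  shows "opposite x \<le> opposite y \<longleftrightarrow> x \<le> y"
  using assms unfolding opposite_def by (auto split: if_splits) presburger+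

text \<open>Negating all labels keeps their order by absolute value and reverses every sign.\<close>

lemma sorted_alternating_opposite:
  assumes "\<And>x y. x \<in> set xs \<Longrightarrow> y \<in> set xs \<Longrightarrow> f x \<noteq> opposite (f y)"
  shows "sorted_alternating b (\<lambda>x. opposite (f x)) xs \<longleftrightarrow> sorted_alternating (\<not> b) f xs"
proof -
  have "sort_key (\<lambda>x. opposite (f x)) xs = sort_key f xs"
    using assms by (intro sort_key_cong_order opposite_le_iff) auto
  then show ?thesis
    using alternating_from_map_Not[of b "map (odd \<circ> f) (sort_key f xs)"]
    by (simp add: sorted_alternating_def comp_def)
qed

subsection \<open>Signed permutations and Ky Fan's lemma\<close>

text \<open>A nonzero vector in $\{-,0,+\}^n$ is a set of signed coordinates. A maximal chain of such
  vectors is a signed permutation \<open>w\<close>; the members of the chain are the sets of entries of the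
  prefixes of \<open>w\<close>.\<close>

definition signed_sets :: "nat \<Rightarrow> (nat \<times> bool) set set" where
  "signed_sets n = {S. S \<noteq> {} \<and> inj_on fst S \<and> fst ` S \<subseteq> {..<n}}"

definition signed_perms :: "nat \<Rightarrow> (nat \<times> bool) list set" where
  "signed_perms n = {w. distinct (map fst w) \<and> fst ` set w = {..<n}}"

abbreviation flip :: "nat \<times> bool \<Rightarrow> nat \<times> bool" where
  "flip \<equiv> map_prod id Not"

lemma flip_flip [simp]: "flip (flip x) = x"
  by (cases x) simp

lemma fst_comp_flip [simp]: "fst \<circ> flip = fst"
  by auto

lemma length_signed_perms: "w \<in> signed_perms n \<Longrightarrow> length w = n"
  using distinct_card[of "map fst w"] by (simp add: signed_perms_def)

lemma finite_signed_perms: "finite (signed_perms n)"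
proof (rule finite_subset)
  show "signed_perms n \<subseteq> {w. set w \<subseteq> {..<n} \<times> UNIV \<and> length w = n}"
  proof
    fix w assume w: "w \<in> signed_perms n"
    then have "set w \<subseteq> {..<n} \<times> UNIV" unfolding signed_perms_def by force
    then show "w \<in> {w. set w \<subseteq> {..<n} \<times> UNIV \<and> length w = n}"
      using length_signed_perms[OF w] by simp
  qed
qed (simp add: finite_lists_length_eq)

lemma signed_perms_0: "signed_perms 0 = {[]}"
  by (auto simp: signed_perms_def)

text \<open>The bound \<open>m \<le> n\<close> views a chain of lower dimension inside dimension
  \<open>n\<close>, so that one labelling serves all steps of the induction on the
  dimension.\<close>

lemma prefix_in_signed_sets:
  assumes "w \<in> signed_perms m" "m \<le> n" "0 < j" "j \<le> m"
  shows "set (take j w) \<in> signed_sets n"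
proof -
  have "set (take j w) \<noteq> {}" using length_signed_perms[OF assms(1)] assms(3,4) by auto
  moreover have "set (take j w) \<subseteq> set w" by (rule set_take_subset)
  moreover have "inj_on fst (set w)" "fst ` set w \<subseteq> {..<n}"
    using assms(1,2) by (auto simp: signed_perms_def distinct_map)
  ultimately show ?thesis unfolding signed_sets_def using inj_on_subset by blast
qed

lemma map_flip_signed_perms: "map flip w \<in> signed_perms n \<longleftrightarrow> w \<in> signed_perms n"
proof -
  have "fst ` set (map flip w) = fst ` set w" by (simp add: image_comp)
  then show ?thesis by (simp add: signed_perms_def)
qed

lemma mem_map_flip: "x \<in> set (map flip w) \<longleftrightarrow> flip x \<in> set w"
proof
  assume "flip x \<in> set w"
  then have "flip (flip x) \<in> flip ` set w" by (rule imageI)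
  then show "x \<in> set (map flip w)" by simp
qed auto

lemma not_flip_mem_signed_perms:
  assumes "w \<in> signed_perms n" "x \<in> set w"
  shows "flip x \<notin> set w"
proof
  assume "flip x \<in> set w"
  moreover have "inj_on fst (set w)" using assms(1) by (simp add: signed_perms_def distinct_map)
  ultimately have "flip x = x" using assms(2) by (intro inj_onD[of fst "set w"]) auto
  then show False by (cases x) auto
qed

definition chain_label :: "((nat \<times> bool) set \<Rightarrow> nat) \<Rightarrow> (nat \<times> bool) list \<Rightarrow> nat \<Rightarrow> nat" where
  "chain_label \<nu> w j = \<nu> (set (take j w))"

text \<open>Positions start at 1 because the empty prefix is not a nonzero vector. Only chains whose
  label of smallest absolute value is positive are counted: for an antipodal labelling, negation
  exchanges them with those starting negative, so counting both kinds would carry no parity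
  information.\<close>

definition alternating_perms :: "((nat \<times> bool) set \<Rightarrow> nat) \<Rightarrow> nat \<Rightarrow> (nat \<times> bool) list set" where
  "alternating_perms \<nu> n = {w \<in> signed_perms n. sorted_alternating True (chain_label \<nu> w) [1..<Suc n]}"

text \<open>The hypotheses of Ky Fan's lemma: signed sets are the vertices of the barycentric
  subdivision of the boundary of a cross-polytope, and inclusions are its edges.\<close>

locale antipodal_labelling =
  fixes \<nu> :: "(nat \<times> bool) set \<Rightarrow> nat" and n :: nat
  assumes antipodal: "S \<in> signed_sets n \<Longrightarrow> \<nu> (flip ` S) = opposite (\<nu> S)"
    and no_opposite: "S \<in> signed_sets n \<Longrightarrow> T \<in> signed_sets n \<Longrightarrow> S \<subseteq> T \<Longrightarrow> \<nu> S \<noteq> opposite (\<nu> T)"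
begin

text \<open>Two prefixes of \<open>w\<close> are nested, so \<open>no_opposite\<close> applies in
  one of the two orders.\<close>

lemma chain_no_opposite:
  assumes "w \<in> signed_perms m" "m \<le> n" "i \<in> {1..m}" "j \<in> {1..m}"
  shows "chain_label \<nu> w i \<noteq> opposite (chain_label \<nu> w j)"
proof -
  have ij: "set (take i w) \<in> signed_sets n" "set (take j w) \<in> signed_sets n"
    using assms by (auto intro: prefix_in_signed_sets)
  consider "set (take i w) \<subseteq> set (take j w)" | "set (take j w) \<subseteq> set (take i w)"
    using set_take_subset_set_take[of i j w] set_take_subset_set_take[of j i w] by linarith
  then show ?thesis
    using no_opposite[OF ij] no_opposite[OF ij(2,1)] opposite_opposite
    unfolding chain_label_def by cases metis+
qed

lemma sorted_alternating_map_flip: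
  assumes "w \<in> signed_perms m" "m \<le> n"
  shows "sorted_alternating b (chain_label \<nu> (map flip w)) [1..<Suc m] \<longleftrightarrow>
    sorted_alternating (\<not> b) (chain_label \<nu> w) [1..<Suc m]"
proof -
  have "chain_label \<nu> (map flip w) j = opposite (chain_label \<nu> w j)" if "j \<in> set [1..<Suc m]" for j
  proof -
    have "0 < j" "j \<le> m" using that by auto
    then show ?thesis
      using antipodal[OF prefix_in_signed_sets[OF assms, of j]] by (simp add: chain_label_def take_map)
  qed
  then have "sorted_alternating b (chain_label \<nu> (map flip w)) [1..<Suc m] \<longleftrightarrow>
    sorted_alternating b (\<lambda>j. opposite (chain_label \<nu> w j)) [1..<Suc m]"
    by (rule sorted_alternating_cong)
  also have "\<dots> \<longleftrightarrow> sorted_alternating (\<not> b) (chain_label \<nu> w) [1..<Suc m]"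
    using chain_no_opposite[OF assms] by (intro sorted_alternating_opposite) auto
  finally show ?thesis .
qed

section \<open>Double counting of faces in a hemisphere\<close>

context
  fixes k :: nat
  assumes k: "Suc k \<le> n"
begin

text \<open>These chains triangulate the closed half of the sphere on which coordinate
  \<open>k\<close> is nonnegative; its boundary is the sphere of the preceding dimension.\<close>

definition hemisphere :: "(nat \<times> bool) list set" where
  "hemisphere = {w \<in> signed_perms (Suc k). (k, True) \<in> set w}"

text \<open>A pair is a maximal chain together with one of its faces of codimension one, the face
  being what remains after member \<open>i\<close> is deleted.\<close>

definition deletions :: "((nat \<times> bool) list \<times> nat) set" where
  "deletions = {(w, i). w \<in> hemisphere \<and> i \<in> {1..Suc k} \<and>
     sorted_alternating True (chain_label \<nu> w) (filter (\<lambda>j. j \<noteq> i) [1..<Suc (Suc k)])}"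

text \<open>The face lies on the boundary when coordinate \<open>k\<close> enters last and the top
  member is the deleted one: no remaining vector then involves \<open>k\<close>.\<close>

definition boundary_deletions :: "((nat \<times> bool) list \<times> nat) set" where
  "boundary_deletions = {(w, i) \<in> deletions. i = Suc k \<and> w ! k = (k, True)}"

text \<open>A face of codimension one that does not lie in the boundary of the hemisphere belongs to
  exactly two maximal chains; this map sends one of them to the other.\<close>

definition across :: "(nat \<times> bool) list \<times> nat \<Rightarrow> (nat \<times> bool) list \<times> nat" where
  "across = (\<lambda>(w, i). (if i \<le> k then w[i - 1 := w ! i, i := w ! (i - 1)] else w[k := flip (w ! k)], i))"

lemma finite_hemisphere: "finite hemisphere"
  using finite_signed_perms by (simp add: hemisphere_def)

lemma finite_deletions: "finite deletions"
  by (rule finite_subset[of _ "hemisphere \<times> {1..Suc k}"])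
    (auto simp: deletions_def finite_hemisphere)

text \<open>Exchanging neighbouring entries alters only the prefix that separates them, and changing
  the last entry alters only the full prefix.\<close>

lemma set_take_across:
  assumes "length w = Suc k" "i \<in> {1..Suc k}" "j \<in> {1..Suc k}" "j \<noteq> i"
  shows "set (take j (fst (across (w, i)))) = set (take j w)"
proof (cases "i \<le> k")
  case True
  show ?thesis
  proof (cases "j < i")
    case False
    then have "take j (w[i - 1 := w ! i, i := w ! (i - 1)]) =
        (take j w)[i - 1 := take j w ! i, i := take j w ! (i - 1)]"
      using assms by (simp add: take_update_swap)
    moreover have "i - 1 < length (take j w)" "i < length (take j w)" using False assms by auto
    ultimately show ?thesis using True by (simp only: across_def set_swap fst_conv if_True case_prod_conv)
  qed (use True assms in \<open>simp add: across_def\<close>)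
qed (use assms in \<open>simp add: across_def\<close>)

lemma sorted_alternating_across:
  assumes "length w = Suc k" "i \<in> {1..Suc k}"
  shows "sorted_alternating True (chain_label \<nu> (fst (across (w, i)))) (filter (\<lambda>j. j \<noteq> i) [1..<Suc (Suc k)])
    \<longleftrightarrow> sorted_alternating True (chain_label \<nu> w) (filter (\<lambda>j. j \<noteq> i) [1..<Suc (Suc k)])"
  using assms by (intro sorted_alternating_cong) (auto simp: chain_label_def set_take_across simp del: upt_Suc)

text \<open>An exchange keeps the set of entries, and a sign change at the end leaves the hemisphere
  only if it hits \<open>(k, True)\<close>, which is the excluded case.\<close>

lemma across_in_hemisphere:
  assumes w: "w \<in> hemisphere" and i: "i \<in> {1..Suc k}" and inner: "\<not> (i = Suc k \<and> w ! k = (k, True))"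
  shows "fst (across (w, i)) \<in> hemisphere"
proof -
  have len: "length w = Suc k" using w length_signed_perms by (auto simp: hemisphere_def)
  show ?thesis
  proof (cases "i \<le> k")
    case True
    let ?w = "w[i - 1 := w ! i, i := w ! (i - 1)]"
    have "set ?w = set w" using True i len by (intro set_swap) auto
    moreover have "map fst ?w = (map fst w)[i - 1 := map fst w ! i, i := map fst w ! (i - 1)]"
      using True i len by (simp add: map_update)
    then have "distinct (map fst ?w) \<longleftrightarrow> distinct (map fst w)"
      using True i len by (simp only: distinct_swap length_map)
    ultimately show ?thesis using w True by (simp add: across_def hemisphere_def signed_perms_def)
  next
    case False
    let ?w = "w[k := flip (w ! k)]"
    have "w ! k \<noteq> (k, True)" using False i inner by auto
    obtain l where l: "l < Suc k" "w ! l = (k, True)"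
      using w len by (auto simp: hemisphere_def in_set_conv_nth)
    with \<open>w ! k \<noteq> (k, True)\<close> have "?w ! l = (k, True)" "l < length ?w"
      using len by (auto simp: nth_list_update)
    then have "(k, True) \<in> set ?w" by (metis nth_mem)
    moreover have "map fst ?w = map fst w"
      using len by (intro nth_equalityI) (auto simp: nth_list_update)
    then have "distinct (map fst ?w) \<longleftrightarrow> distinct (map fst w)" "fst ` set ?w = fst ` set w"
      by (simp_all only: flip: set_map)
    ultimately show ?thesis using w False by (simp add: across_def hemisphere_def signed_perms_def)
  qed
qed

lemma even_inner_deletions: "even (card (deletions - boundary_deletions))"
proof (rule even_card_involution)
  show "finite (deletions - boundary_deletions)" using finite_deletions by blast
next
  fix x assume "x \<in> deletions - boundary_deletions"
  then obtain w i where x: "x = (w, i)" and w: "w \<in> hemisphere" and i: "i \<in> {1..Suc k}"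
    and alt: "sorted_alternating True (chain_label \<nu> w) (filter (\<lambda>j. j \<noteq> i) [1..<Suc (Suc k)])"
    and inner: "\<not> (i = Suc k \<and> w ! k = (k, True))"
    by (auto simp: deletions_def boundary_deletions_def)
  have len: "length w = Suc k" using w length_signed_perms by (auto simp: hemisphere_def)
  have perm: "w \<in> signed_perms (Suc k)" and mem: "(k, True) \<in> set w"
    using w by (auto simp: hemisphere_def)
  have "distinct w" using perm by (auto simp: signed_perms_def distinct_map)
  have neq: "flip (w ! k) \<noteq> w ! k" by (cases "w ! k") auto
  have snd: "snd (across x) = i" by (simp add: across_def x)
  \<comment> \<open>If flipping the last entry produced \<open>(k, True)\<close>, the chain would
    contain both signs of coordinate \<open>k\<close>; so \<open>across\<close> never enters the
    boundary case.\<close>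
  have "\<not> (i = Suc k \<and> fst (across x) ! k = (k, True))"
  proof
    assume *: "i = Suc k \<and> fst (across x) ! k = (k, True)"
    then have "\<not> i \<le> k" by simp
    with * have "flip (w ! k) = (k, True)" using len by (simp add: across_def x)
    moreover have "w ! k \<in> set w" using len by simp
    ultimately show False using not_flip_mem_signed_perms[OF perm] mem by metis
  qed
  then show "across x \<in> deletions - boundary_deletions"
    using across_in_hemisphere[OF w i inner] sorted_alternating_across[OF len i] alt i snd
    by (cases "across x") (auto simp: deletions_def boundary_deletions_def x)
  show "across (across x) = x"
  proof (cases "i \<le> k")
    case True
    then have "i - 1 \<noteq> i" "i - 1 < Suc k" "i < Suc k" using i by auto
    then show ?thesis using True len
      by (auto simp: across_def x nth_list_update intro!: nth_equalityI)
  next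
    case False
    then show ?thesis using len by (simp add: across_def x)
  qed
  show "across x \<noteq> x"
  proof (cases "i \<le> k")
    case True
    then have ii: "i - 1 \<noteq> i" "i - 1 < length w" "i < length w" using i len by auto
    then have "w ! (i - 1) \<noteq> w ! i" using \<open>distinct w\<close> by (simp add: nth_eq_iff_index_eq)
    moreover have "fst (across x) ! i = w ! (i - 1)" using ii True by (simp add: across_def x)
    ultimately show ?thesis by (auto simp: x)
  next
    case False
    then have "fst (across x) ! k = flip (w ! k)" using len by (simp add: across_def x)
    with neq show ?thesis by (auto simp: x)
  qed
qed

text \<open>Appending \<open>(k, True)\<close> to a chain of the boundary sphere gives the only
  maximal chain of the hemisphere that contains it, and the labels surviving the deletion are
  unchanged.\<close>

lemma card_boundary_deletions: "card boundary_deletions = card (alternating_perms \<nu> k)"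
proof (rule bij_betw_same_card[symmetric])
  let ?f = "\<lambda>v. (v @ [(k, True)], Suc k)"
  have perm: "v @ [(k, True)] \<in> signed_perms (Suc k) \<longleftrightarrow> v \<in> signed_perms k" for v
  proof -
    have "insert k (fst ` set v) = {..<Suc k} \<longleftrightarrow> fst ` set v = {..<k}" if "k \<notin> fst ` set v"
      using that by (auto simp: lessThan_Suc insert_eq_iff)
    then show ?thesis by (auto simp: signed_perms_def lessThan_Suc)
  qed
  have upt: "filter (\<lambda>j. j \<noteq> Suc k) [1..<Suc (Suc k)] = [1..<Suc k]"
  proof -
    have "filter (\<lambda>j. j \<noteq> Suc k) [1..<Suc k] = [1..<Suc k]" by (rule filter_True) auto
    moreover have "[1..<Suc (Suc k)] = [1..<Suc k] @ [Suc k]" by simp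
    ultimately show ?thesis by (simp only: filter_append) simp
  qed
  have lab: "sorted_alternating True (chain_label \<nu> (v @ [(k, True)])) [1..<Suc k] \<longleftrightarrow>
      sorted_alternating True (chain_label \<nu> v) [1..<Suc k]" if "v \<in> signed_perms k" for v
  proof (rule sorted_alternating_cong)
    fix j assume "j \<in> set [1..<Suc k]"
    then have "j \<le> length v" using length_signed_perms[OF that] by auto
    then show "chain_label \<nu> (v @ [(k, True)]) j = chain_label \<nu> v j" by (simp add: chain_label_def)
  qed
  have mem: "(w, i) \<in> boundary_deletions \<longleftrightarrow> i = Suc k \<and> w \<in> signed_perms (Suc k) \<and>
      w ! k = (k, True) \<and> sorted_alternating True (chain_label \<nu> w) [1..<Suc k]" for w i
  proof (cases "i = Suc k")
    case True
    have "(k, True) \<in> set w" if "w \<in> signed_perms (Suc k)" "w ! k = (k, True)"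
      using length_signed_perms[OF that(1)] that(2) by (metis lessI nth_mem)
    with True show ?thesis
      unfolding boundary_deletions_def deletions_def hemisphere_def by (auto simp only: upt) simp_all
  qed (simp add: boundary_deletions_def)
  show "bij_betw ?f (alternating_perms \<nu> k) boundary_deletions"
    unfolding bij_betw_def
  proof
    show "inj_on ?f (alternating_perms \<nu> k)" by (rule inj_onI) simp
    show "?f ` alternating_perms \<nu> k = boundary_deletions"
    proof (intro set_eqI iffI)
      fix x assume "x \<in> ?f ` alternating_perms \<nu> k"
      then obtain v where v: "v \<in> signed_perms k" "x = ?f v"
        "sorted_alternating True (chain_label \<nu> v) [1..<Suc k]"
        unfolding alternating_perms_def by blast
      moreover have "(v @ [(k, True)]) ! k = (k, True)"
        using length_signed_perms[OF v(1)] by (metis nth_append_length)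
      ultimately show "x \<in> boundary_deletions" using mem perm lab by blast
    next
      fix x assume "x \<in> boundary_deletions"
      then obtain w where x: "x = (w, Suc k)" and w: "w \<in> signed_perms (Suc k)" "w ! k = (k, True)"
        and alt: "sorted_alternating True (chain_label \<nu> w) [1..<Suc k]"
        using mem by (cases x) blast
      have "w = butlast w @ [(k, True)]"
        using length_signed_perms[OF w(1)] w(2)
        by (metis append_butlast_last_id diff_Suc_1 last_conv_nth length_0_conv nat.distinct(1))
      with w alt perm lab have "butlast w \<in> alternating_perms \<nu> k" "x = ?f (butlast w)"
        unfolding alternating_perms_def x by (metis (no_types, lifting) mem_Collect_eq, metis)
      then show "x \<in> ?f ` alternating_perms \<nu> k" by blast
    qed
  qed
qed

text \<open>The set \<open>deletions\<close> is counted in two ways modulo 2. By faces, the interior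
  ones cancel and the boundary contributes the alternating chains of dimension \<open>k\<close>. By
  chains, exactly those of the hemisphere that alternate, starting with either sign, contribute an
  odd number; negating the ones that start negative yields the positive ones of the other
  hemisphere.\<close>

lemma odd_card_alternating_perms_step:
  "odd (card (alternating_perms \<nu> (Suc k))) \<longleftrightarrow> odd (card (alternating_perms \<nu> k))"
proof -
  let ?alt = "\<lambda>b w. sorted_alternating b (chain_label \<nu> w) [1..<Suc (Suc k)]"
  let ?H = "\<lambda>b. {w \<in> hemisphere. ?alt b w}"
  let ?D = "\<lambda>w. {i \<in> set [1..<Suc (Suc k)].
    sorted_alternating True (chain_label \<nu> w) (filter (\<lambda>j. j \<noteq> i) [1..<Suc (Suc k)])}"
  have lower: "map flip ` ?H False = {w \<in> alternating_perms \<nu> (Suc k). (k, True) \<notin> set w}" (is "_ = ?L")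
  proof (intro set_eqI iffI)
    fix w assume "w \<in> map flip ` ?H False"
    then obtain v where v: "w = map flip v" "v \<in> signed_perms (Suc k)" "(k, True) \<in> set v" "?alt False v"
      unfolding hemisphere_def by blast
    have "(k, True) \<notin> set w"
    proof
      assume "(k, True) \<in> set w"
      then have "flip (k, True) \<in> set v" using v(1) mem_map_flip by metis
      then show False using not_flip_mem_signed_perms[OF v(2,3)] by blast
    qed
    moreover have "?alt True w" 
      unfolding v(1) using sorted_alternating_map_flip[OF v(2) k, of True] v(4) by (simp del: upt_Suc)
    ultimately show "w \<in> ?L"
      using v(1,2) map_flip_signed_perms unfolding alternating_perms_def by blast
  next
    fix w assume w: "w \<in> ?L"
    then have perm: "w \<in> signed_perms (Suc k)" and "?alt True w" "(k, True) \<notin> set w"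
      unfolding alternating_perms_def by blast+
    have "k \<in> fst ` set w" using perm unfolding signed_perms_def by blast
    then obtain b where "(k, b) \<in> set w" by auto
    with \<open>(k, True) \<notin> set w\<close> have "(k, False) \<in> set w" by (cases b) simp_all
    then have "(k, True) \<in> set (map flip w)" by (simp add: mem_map_flip del: set_map)
    moreover have "?alt False (map flip w)"
      using sorted_alternating_map_flip[OF perm k] \<open>?alt True w\<close> by (simp del: upt_Suc)
    ultimately have "map flip w \<in> ?H False"
      using perm map_flip_signed_perms unfolding hemisphere_def by blast
    moreover have "w = map flip (map flip w)" by (simp add: comp_def)
    ultimately show "w \<in> map flip ` ?H False" by (rule rev_image_eqI)
  qed
  have "inj_on (map flip) (?H False)" 
    by (rule inj_on_inverseI[where g = "map flip"]) (simp add: comp_def)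
  then have cardL: "card ?L = card (?H False)" unfolding lower[symmetric] by (rule card_image)
  have "alternating_perms \<nu> (Suc k) = ?H True \<union> ?L" "?H True \<inter> ?L = {}"
    unfolding alternating_perms_def hemisphere_def by blast+
  moreover have "finite (alternating_perms \<nu> (Suc k))"
    using finite_signed_perms unfolding alternating_perms_def by (rule finite_subset[rotated]) blast
  ultimately have card_next: "card (alternating_perms \<nu> (Suc k)) = card (?H True) + card (?H False)"
    using cardL by (metis (no_types, lifting) card_Un_disjoint finite_Un)
  \<comment> \<open>A chain here has at least one label, so its first sign is determined.\<close>
  have disj: "\<not> (?alt True w \<and> ?alt False w)" for w
  proof -
    have "sort_key (chain_label \<nu> w) [1..<Suc (Suc k)] \<noteq> []"
      by (simp only: length_0_conv[symmetric] length_sort length_upt)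
    then show ?thesis
      unfolding sorted_alternating_def using alternating_from_unique map_is_Nil_conv by metis
  qed
  then have "?H True \<inter> ?H False = {}" by blast
  then have card_Un: "card (?H True \<union> ?H False) = card (?H True) + card (?H False)"
    using finite_hemisphere by (intro card_Un_disjoint) auto
  have "deletions = Sigma hemisphere ?D"
    unfolding deletions_def by (auto simp del: upt_Suc)
  then have "card deletions = (\<Sum>w\<in>hemisphere. card (?D w))"
    using finite_hemisphere by simp
  moreover have "odd (card (?D w)) \<longleftrightarrow> ?alt True w \<or> ?alt False w" for w
  proof -
    show ?thesis
      using disj[of w] parity_sorted_alternating_deletions[of "[1..<Suc (Suc k)]" True "chain_label \<nu> w"]
      by (simp only: distinct_upt not_True_eq_False) blast
  qed
  then have "{w \<in> hemisphere. odd (card (?D w))} = ?H True \<union> ?H False" by blast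
  ultimately have "odd (card deletions) \<longleftrightarrow> odd (card (?H True \<union> ?H False))"
    using even_sum_iff[OF finite_hemisphere, of "\<lambda>w. card (?D w)"] by simp
  then have "odd (card deletions) \<longleftrightarrow> odd (card (alternating_perms \<nu> (Suc k)))"
    using card_Un card_next by simp
  moreover have "boundary_deletions \<subseteq> deletions" unfolding boundary_deletions_def by blast
  then have "card deletions = card (deletions - boundary_deletions) + card boundary_deletions"
    using finite_deletions by (metis card_Diff_subset card_mono finite_subset le_add_diff_inverse2)
  ultimately show ?thesis using even_inner_deletions card_boundary_deletions by simp
qed

end

text \<open>The empty chain is the only one in dimension 0 and alternates vacuously.\<close>

lemma odd_card_alternating_perms: "m \<le> n \<Longrightarrow> odd (card (alternating_perms \<nu> m))"
proof (induction m)
  case 0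
  then show ?case by (simp add: alternating_perms_def signed_perms_0 sorted_alternating_def)
next
  case (Suc m)
  then show ?case using odd_card_alternating_perms_step[of m] by simp
qed

text \<open>Ky Fan's lemma for the barycentric subdivision of the cross-polytope.\<close>

lemma ky_fan:
  obtains w where "w \<in> signed_perms n" "sorted_alternating True (chain_label \<nu> w) [1..<Suc n]"
proof -
  have "alternating_perms \<nu> n \<noteq> {}" using odd_card_alternating_perms[of n] by force
  then show thesis using that unfolding alternating_perms_def by blast
qed

end

subsection \<open>Alternation numbers of sign vectors\<close>

lemma alt_vec_attained:
  obtains xs where "subseq xs X" "alternating xs" "length xs = alt_vec X"
proof -
  have "alt_vec X \<in> {length xs | xs. subseq xs X \<and> alternating xs}"
    unfolding alt_vec_def using zero_alternating_length
    by (intro Max_in[OF finite_alternating_lengths]) blast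
  then show thesis using that by auto
qed

lemma length_le_alt_vec: "subseq xs X \<Longrightarrow> alternating xs \<Longrightarrow> length xs \<le> alt_vec X"
  unfolding alt_vec_def by (rule Max_ge[OF finite_alternating_lengths]) blast

text \<open>Otherwise the first nonzero entry could be prepended.\<close>

lemma hd_longest_alternating:
  assumes "subseq xs X" "alternating xs" "length xs = alt_vec X" "xs \<noteq> []"
  shows "hd xs = hd (filter (\<lambda>s. s \<noteq> Zero) X)"
proof (rule ccontr)
  assume neq: "hd xs \<noteq> hd (filter (\<lambda>s. s \<noteq> Zero) X)"
  have "filter (\<lambda>s. s \<noteq> Zero) xs = xs"
    using assms(2) by (auto simp: alternating_def filter_id_conv)
  then have sub: "subseq xs (filter (\<lambda>s. s \<noteq> Zero) X)"
    using subseq_filter[OF assms(1), of "\<lambda>s. s \<noteq> Zero"] by simp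
  then obtain y ys where ys: "filter (\<lambda>s. s \<noteq> Zero) X = y # ys"
    using assms(4) by (cases "filter (\<lambda>s. s \<noteq> Zero) X") auto
  obtain z zs where zs: "xs = z # zs" using assms(4) by (cases xs) auto
  have "z \<noteq> y" using neq ys zs by simp
  then have "subseq (y # xs) (y # ys)" using sub ys zs by simp
  then have "subseq (y # xs) X"
    unfolding ys[symmetric] using subseq_filter_left subseq_order.order_trans by blast
  moreover have "y \<in> set (filter (\<lambda>s. s \<noteq> Zero) X)" unfolding ys by simp
  then have "y \<noteq> Zero" by simp
  then have "alternating (y # xs)" using assms(2) zs \<open>z \<noteq> y\<close> by (auto simp: alternating_def)
  ultimately have "length (y # xs) \<le> alt_vec X" by (rule length_le_alt_vec)
  then show False using assms(3) by simp
qed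

fun opposite_sign :: "sign \<Rightarrow> sign" where
  "opposite_sign Minus = Plus"
| "opposite_sign Zero = Zero"
| "opposite_sign Plus = Minus"

lemma opposite_sign_opposite_sign [simp]: "opposite_sign (opposite_sign s) = s"
  by (cases s) auto

lemma opposite_sign_eq_iff [simp]: "opposite_sign s = opposite_sign s' \<longleftrightarrow> s = s'"
  by (metis opposite_sign_opposite_sign)

lemma opposite_sign_eq_Zero_iff [simp]: "opposite_sign s = Zero \<longleftrightarrow> s = Zero"
  by (cases s) auto

lemma alternating_map_opposite_sign: "alternating xs \<Longrightarrow> alternating (map opposite_sign xs)"
  by (auto simp: alternating_def successively_map)
    (metis opposite_sign.simps(2) opposite_sign_opposite_sign)

lemma alt_vec_map_opposite_sign: "alt_vec (map opposite_sign X) = alt_vec X"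
proof -
  have *: "alt_vec X \<le> alt_vec (map opposite_sign X)" for X
  proof -
    obtain xs where "subseq xs X" "alternating xs" and len: "length xs = alt_vec X"
      by (rule alt_vec_attained)
    then have "length (map opposite_sign xs) \<le> alt_vec (map opposite_sign X)"
      by (intro length_le_alt_vec subseq_map alternating_map_opposite_sign)
    then show ?thesis using len by simp
  qed
  from *[of X] *[of "map opposite_sign X"] show ?thesis by (simp add: comp_def)
qed

text \<open>Passes from sets of signed coordinates, suited to chains, to the lists on which
  \<open>alt_vec\<close> is defined. If both signs of a coordinate occurred, \<open>Plus\<close>
  would win; this never happens in \<open>signed_sets\<close>.\<close>

definition sign_vector :: "nat \<Rightarrow> (nat \<times> bool) set \<Rightarrow> sign list" where
  "sign_vector n S = map (\<lambda>i. if (i, True) \<in> S then Plus else if (i, False) \<in> S then Minus else Zero) [0..<n]"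

abbreviation alt_set :: "nat \<Rightarrow> (nat \<times> bool) set \<Rightarrow> nat" where
  "alt_set n S \<equiv> alt_vec (sign_vector n S)"

text \<open>The sign of the labels of absolute value at most \<open>k\<close>. The filtered list has
  a head only for a nonzero vector.\<close>

definition leading_sign :: "nat \<Rightarrow> (nat \<times> bool) set \<Rightarrow> sign" where
  "leading_sign n S = hd (filter (\<lambda>s. s \<noteq> Zero) (sign_vector n S))"

lemma flip_mem_image: "(i, b) \<in> flip ` S \<longleftrightarrow> (i, \<not> b) \<in> S"
  by force

lemma signed_sets_exclusive: "S \<in> signed_sets n \<Longrightarrow> \<not> ((i, True) \<in> S \<and> (i, False) \<in> S)"
  unfolding signed_sets_def using inj_onD[of fst S "(i, True)" "(i, False)"] by auto

lemma signed_sets_less: "S \<in> signed_sets n \<Longrightarrow> (i, b) \<in> S \<Longrightarrow> i < n"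
  unfolding signed_sets_def by force

lemma sign_vector_in_sign_vectors: "sign_vector n S \<in> sign_vectors n"
  by (simp add: sign_vector_def sign_vectors_def)

lemma pos_sign_vector: "S \<in> signed_sets n \<Longrightarrow> pos (sign_vector n S) = {i. (i, True) \<in> S}"
  using signed_sets_less[of S n] by (auto simp: sign_vector_def pos_def split: if_splits)

lemma neg_sign_vector: "S \<in> signed_sets n \<Longrightarrow> neg (sign_vector n S) = {i. (i, False) \<in> S}"
  using signed_sets_less[of S n] signed_sets_exclusive[of S n]
  by (auto simp: sign_vector_def neg_def split: if_splits)

lemma sign_vector_flip:
  assumes "S \<in> signed_sets n"
  shows "sign_vector n (flip ` S) = map opposite_sign (sign_vector n S)"
  using signed_sets_exclusive[OF assms] by (auto simp: sign_vector_def flip_mem_image)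

lemma filter_sign_vector_nonempty:
  assumes "S \<in> signed_sets n"
  shows "filter (\<lambda>s. s \<noteq> Zero) (sign_vector n S) \<noteq> []"
proof -
  obtain i b where "(i, b) \<in> S" using assms by (auto simp: signed_sets_def)
  moreover from this assms have "i < n" by (auto dest: signed_sets_less)
  ultimately have "sign_vector n S ! i \<noteq> Zero" by (cases b) (auto simp: sign_vector_def)
  moreover have "sign_vector n S ! i \<in> set (sign_vector n S)"
    using \<open>i < n\<close> by (simp add: sign_vector_def)
  ultimately have "\<exists>s \<in> set (sign_vector n S). s \<noteq> Zero" by blast
  then show ?thesis by (simp add: filter_empty_conv)
qed

lemma alt_set_pos:
  assumes "S \<in> signed_sets n"
  shows "0 < alt_set n S"
proof -
  obtain s ys where s: "filter (\<lambda>s. s \<noteq> Zero) (sign_vector n S) = s # ys"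
    using filter_sign_vector_nonempty[OF assms] by (cases "filter (\<lambda>s. s \<noteq> Zero) (sign_vector n S)") auto
  have "s \<in> set (filter (\<lambda>s. s \<noteq> Zero) (sign_vector n S))" unfolding s by simp
  then have "s \<in> set (sign_vector n S)" "s \<noteq> Zero" by simp_all
  then have "length [s] \<le> alt_set n S"
    by (intro length_le_alt_vec) (auto simp: subseq_singleton_left alternating_def)
  then show ?thesis by simp
qed

lemma leading_sign_nonzero: "S \<in> signed_sets n \<Longrightarrow> leading_sign n S \<noteq> Zero"
  using hd_in_set[OF filter_sign_vector_nonempty] by (auto simp: leading_sign_def)

lemma leading_sign_flip:
  assumes "S \<in> signed_sets n"
  shows "leading_sign n (flip ` S) = opposite_sign (leading_sign n S)"
  using filter_sign_vector_nonempty[OF assms]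
  by (simp add: leading_sign_def sign_vector_flip[OF assms] filter_map comp_def hd_map)

text \<open>Enlarging a vector turns zeros into signs and leaves the other entries as they
  are.\<close>

lemma subseq_filter_sign_vector:
  assumes "S \<subseteq> T" "T \<in> signed_sets n"
  shows "subseq (filter (\<lambda>s. s \<noteq> Zero) (sign_vector n S)) (filter (\<lambda>s. s \<noteq> Zero) (sign_vector n T))"
proof -
  have sub: "subseq (filter (\<lambda>s. s \<noteq> Zero) (map f is)) (filter (\<lambda>s. s \<noteq> Zero) (map g is))"
    if "\<And>i. i \<in> set is \<Longrightarrow> f i \<noteq> Zero \<Longrightarrow> g i = f i" for f g :: "nat \<Rightarrow> sign" and "is"
    using that
  proof (induction "is")
    case (Cons i "is")
    then have "subseq (filter (\<lambda>s. s \<noteq> Zero) (map f is)) (filter (\<lambda>s. s \<noteq> Zero) (map g is))" by simp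
    with Cons.prems[of i] show ?case by (cases "f i = Zero") (simp_all add: list_emb_Cons)
  qed simp
  show ?thesis
    unfolding sign_vector_def
    by (rule sub) (use assms(1) signed_sets_exclusive[OF assms(2)] in \<open>auto split: if_splits\<close>)
qed

text \<open>A longest alternating subsequence of the smaller vector is also longest in the larger
  one, and its first entry is the leading sign of both by
  \<open>hd_longest_alternating\<close>.\<close>

lemma leading_sign_eq:
  assumes "S \<subseteq> T" "S \<in> signed_sets n" "T \<in> signed_sets n" "alt_set n S = alt_set n T"
  shows "leading_sign n S = leading_sign n T"
proof -
  obtain xs where xs: "subseq xs (sign_vector n S)" "alternating xs" "length xs = alt_set n S"
    by (rule alt_vec_attained)
  have "filter (\<lambda>s. s \<noteq> Zero) xs = xs"
    using xs(2) by (auto simp: alternating_def filter_id_conv)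
  then have "subseq xs (filter (\<lambda>s. s \<noteq> Zero) (sign_vector n S))"
    using subseq_filter[OF xs(1), of "\<lambda>s. s \<noteq> Zero"] by simp
  then have "subseq xs (sign_vector n T)"
    using subseq_filter_sign_vector[OF assms(1,3)] subseq_filter_left
    by (meson subseq_order.order_trans)
  moreover have "xs \<noteq> []" using xs(3) alt_set_pos[OF assms(2)] by auto
  ultimately show ?thesis
    using hd_longest_alternating[of xs] xs assms(4) unfolding leading_sign_def by metis
qed

subsection \<open>Colourings of Kneser graphs\<close>

text \<open>Positivity of the colours keeps the labels coming from edges above \<open>k\<close>.
  Taking \<open>e = f\<close> in \<open>proper\<close> rules out the empty edge.\<close>

locale coloured_kneser =
  fixes E :: "'a set set" and c :: "'a set \<Rightarrow> nat" and n :: nat and \<sigma> :: "nat \<Rightarrow> 'a"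
  assumes finite_edges: "finite E"
    and proper: "e \<in> E \<Longrightarrow> f \<in> E \<Longrightarrow> e \<inter> f = {} \<Longrightarrow> c e \<noteq> c f"
    and colour_pos: "e \<in> E \<Longrightarrow> 0 < c e"
    and inj: "inj_on \<sigma> {..<n}"
begin

definition side :: "bool \<Rightarrow> (nat \<times> bool) set \<Rightarrow> 'a set" where
  "side b S = \<sigma> ` {i. (i, b) \<in> S}"

text \<open>The edges of both sides compete here; \<open>dominant\<close> records which side wins.
  The maximum is meaningful only if some side contains an edge.\<close>

definition max_colour :: "(nat \<times> bool) set \<Rightarrow> nat" where
  "max_colour S = Max (c ` {e \<in> E. \<exists>b. e \<subseteq> side b S})"

definition dominant :: "(nat \<times> bool) set \<Rightarrow> bool" where
  "dominant S \<longleftrightarrow> (\<exists>e\<in>E. e \<subseteq> side True S \<and> c e = max_colour S)"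

lemma side_flip: "side b (flip ` S) = side (\<not> b) S"
  by (simp add: side_def flip_mem_image)

lemma side_mono: "S \<subseteq> T \<Longrightarrow> side b S \<subseteq> side b T"
  by (auto simp: side_def)

lemma sides_disjoint:
  assumes "S \<in> signed_sets n" "b \<noteq> b'"
  shows "side b S \<inter> side b' S = {}"
proof -
  have *: "side True S \<inter> side False S = {}"
  proof (rule equals0I)
    fix x assume "x \<in> side True S \<inter> side False S"
    then obtain i j where ij: "x = \<sigma> i" "x = \<sigma> j" "(i, True) \<in> S" "(j, False) \<in> S"
      unfolding side_def by blast
    moreover have "i < n" "j < n" using ij signed_sets_less[OF assms(1)] by blast+
    ultimately have "i = j" using inj_onD[OF inj, of i j] by simp
    then show False using ij signed_sets_exclusive[OF assms(1)] by blast
  qed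
  then show ?thesis using assms(2) by (cases b; cases b') auto
qed

text \<open>Edges on different sides are disjoint, so properness gives them different
  colours.\<close>

lemma same_colour_same_side:
  assumes "S \<in> signed_sets n" "e \<in> E" "f \<in> E" "e \<subseteq> side b S" "f \<subseteq> side b' S" "c e = c f"
  shows "b = b'"
  using proper[OF assms(2,3)] sides_disjoint[OF assms(1), of b b'] assms(4-6) by blast

lemma colour_le_max: "e \<in> E \<Longrightarrow> e \<subseteq> side b S \<Longrightarrow> c e \<le> max_colour S"
  unfolding max_colour_def using finite_edges by (intro Max_ge) auto

text \<open>All edges of the largest colour lie on one side by \<open>same_colour_same_side\<close>,
  so the truth value of \<open>dominant\<close>, which mentions only the positive side, names that
  side.\<close>

lemma dominant_edge:
  assumes S: "S \<in> signed_sets n" and ex: "\<exists>e\<in>E. \<exists>b. e \<subseteq> side b S"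
  shows "\<exists>e\<in>E. e \<subseteq> side (dominant S) S \<and> c e = max_colour S"
proof -
  have "max_colour S \<in> c ` {e \<in> E. \<exists>b. e \<subseteq> side b S}"
    unfolding max_colour_def using finite_edges ex by (intro Max_in) auto
  then obtain e b where e: "e \<in> E" "e \<subseteq> side b S" "c e = max_colour S" by auto
  have "b = dominant S"
  proof (cases b)
    case True
    then have "dominant S" unfolding dominant_def using e by auto
    with True show ?thesis by simp
  next
    case False
    have "\<not> dominant S"
    proof
      assume "dominant S"
      then obtain f where f: "f \<in> E" "f \<subseteq> side True S" "c f = max_colour S"
        unfolding dominant_def by blast
      then have "True = b" using e by (intro same_colour_same_side[OF S f(1) e(1)]) simp_all
      with False show False by simp
    qed
    with False show ?thesis by simp
  qed
  with e show ?thesis by blast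
qed

lemma max_colour_flip: "max_colour (flip ` S) = max_colour S"
proof -
  have "(\<exists>b. e \<subseteq> side b (flip ` S)) \<longleftrightarrow> (\<exists>b. e \<subseteq> side b S)" for e
    by (auto simp: side_flip ex_bool_eq)
  then show ?thesis by (simp add: max_colour_def)
qed

lemma flip_in_signed_sets: "S \<in> signed_sets n \<Longrightarrow> flip ` S \<in> signed_sets n"
  by (auto simp: signed_sets_def inj_on_def)

text \<open>The largest colour is common to \<open>S\<close> and its negation, and the edges
  attaining it lie on one side of \<open>S\<close>; negation only exchanges the names of the
  sides.\<close>

lemma dominant_flip:
  assumes "S \<in> signed_sets n" "\<exists>e\<in>E. \<exists>b. e \<subseteq> side b S"
  shows "dominant (flip ` S) \<longleftrightarrow> \<not> dominant S"
proof -
  obtain e where e: "e \<in> E" "e \<subseteq> side (dominant S) S" "c e = max_colour S"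
    using dominant_edge[OF assms] by blast
  have "e \<subseteq> side (\<not> dominant S) (flip ` S)" using e(2) by (simp add: side_flip)
  then obtain f where f: "f \<in> E" "f \<subseteq> side (dominant (flip ` S)) (flip ` S)" "c f = max_colour S"
    using dominant_edge[OF flip_in_signed_sets[OF assms(1)]] e(1) unfolding max_colour_flip by blast
  have "(\<not> dominant (flip ` S)) = dominant S"
    by (rule same_colour_same_side[OF assms(1) f(1) e(1)]) (use e f in \<open>simp_all add: side_flip\<close>)
  then show ?thesis by blast
qed

section \<open>The labelling of sign vectors by alternation and colours\<close>

definition label_value :: "nat \<Rightarrow> (nat \<times> bool) set \<Rightarrow> nat" where
  "label_value k S = (if alt_set n S \<le> k then alt_set n S else k + max_colour S)"

definition label_sign :: "nat \<Rightarrow> (nat \<times> bool) set \<Rightarrow> bool" where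
  "label_sign k S \<longleftrightarrow> (if alt_set n S \<le> k then leading_sign n S = Plus else dominant S)"

definition label :: "nat \<Rightarrow> (nat \<times> bool) set \<Rightarrow> nat" where
  "label k S = 2 * label_value k S + of_bool (label_sign k S)"

text \<open>This is what the choice of \<open>k\<close> has to guarantee; it holds for both
  alternation numbers of the ordering \<open>\<sigma>\<close>.\<close>

context
  fixes k :: nat
  assumes edge: "S \<in> signed_sets n \<Longrightarrow> k < alt_set n S \<Longrightarrow> \<exists>e\<in>E. \<exists>b. e \<subseteq> side b S"
begin

text \<open>Colours are positive, so the two kinds of label never share an absolute value.\<close>

lemma label_value_le_iff:
  assumes "S \<in> signed_sets n"
  shows "label_value k S \<le> k \<longleftrightarrow> alt_set n S \<le> k"
proof (cases "alt_set n S \<le> k")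
  case False
  then obtain e b where e: "e \<in> E" "e \<subseteq> side b S" using edge[OF assms] by auto
  then have "0 < max_colour S"
    using colour_pos[OF e(1)] colour_le_max[OF e] by linarith
  with False show ?thesis by (simp add: label_value_def)
qed (simp add: label_value_def)

lemma label_value_pos: "S \<in> signed_sets n \<Longrightarrow> 0 < label_value k S"
  using label_value_le_iff[of S] alt_set_pos[of S n] by (cases "alt_set n S \<le> k") (auto simp: label_value_def)

lemma label_antipodal:
  assumes S: "S \<in> signed_sets n"
  shows "label k (flip ` S) = opposite (label k S)"
proof -
  have alt: "alt_set n (flip ` S) = alt_set n S"
    by (simp add: sign_vector_flip[OF S] alt_vec_map_opposite_sign)
  then have "label_value k (flip ` S) = label_value k S"
    by (simp add: label_value_def max_colour_flip)
  moreover have "label_sign k (flip ` S) \<longleftrightarrow> \<not> label_sign k S"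
  proof (cases "alt_set n S \<le> k")
    case True
    then show ?thesis
      using leading_sign_nonzero[OF S] alt
      by (cases "leading_sign n S") (simp_all add: label_sign_def leading_sign_flip[OF S])
  next
    case False
    then show ?thesis
      using dominant_flip[OF S edge[OF S]] alt by (simp add: label_sign_def)
  qed
  ultimately show ?thesis by (simp add: label_def)
qed

lemma label_eq_opposite_iff:
  "label k S = opposite (label k T) \<longleftrightarrow>
    label_value k S = label_value k T \<and> (label_sign k S \<longleftrightarrow> \<not> label_sign k T)"
proof -
  have "label k S = opposite (label k T) \<longleftrightarrow>
      2 * label_value k S + of_bool (label_sign k S) = 2 * label_value k T + of_bool (\<not> label_sign k T)"
    by (simp only: label_def opposite_encode)
  also have "\<dots> \<longleftrightarrow> label_value k S = label_value k T \<and> (label_sign k S \<longleftrightarrow> \<not> label_sign k T)"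
    by (cases "label_sign k S"; cases "label_sign k T") (simp_all, presburger+)
  finally show ?thesis .
qed

text \<open>Labels of equal absolute value are of the same kind. If they are alternation numbers,
  the leading signs agree by \<open>leading_sign_eq\<close>; if they come from edges, both edges lie
  within sides of \<open>T\<close> and have the same colour, hence are on the same side.\<close>

lemma label_no_opposite:
  assumes S: "S \<in> signed_sets n" and T: "T \<in> signed_sets n" and "S \<subseteq> T"
  shows "label k S \<noteq> opposite (label k T)"
proof
  assume "label k S = opposite (label k T)"
  then have val: "label_value k S = label_value k T" and sgn: "label_sign k S \<noteq> label_sign k T"
    unfolding label_eq_opposite_iff by blast+
  show False
  proof (cases "alt_set n S \<le> k")
    case True
    then have "alt_set n T \<le> k" using label_value_le_iff[OF S] label_value_le_iff[OF T] val by simp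
    with True val sgn show False
      using leading_sign_eq[OF \<open>S \<subseteq> T\<close> S T] by (simp add: label_value_def label_sign_def)
  next
    case False
    then have T': "\<not> alt_set n T \<le> k" using label_value_le_iff[OF S] label_value_le_iff[OF T] val by simp
    obtain e where e: "e \<in> E" "e \<subseteq> side (dominant S) S" "c e = max_colour S"
      using dominant_edge[OF S edge[OF S]] False by auto
    obtain f where f: "f \<in> E" "f \<subseteq> side (dominant T) T" "c f = max_colour T"
      using dominant_edge[OF T edge[OF T]] T' by auto
    have "dominant S = dominant T"
      using same_colour_same_side[OF T e(1) f(1) _ f(2)] e f side_mono[OF \<open>S \<subseteq> T\<close>] val False T'
      by (simp add: label_value_def) blast
    with sgn False T' show False by (simp add: label_sign_def)
  qed
qed

lemma antipodal_labelling_label: "antipodal_labelling (label k) n"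
  by unfold_locales (simp_all only: label_antipodal label_no_opposite not_False_eq_True)

text \<open>At most \<open>k\<close> of the \<open>n\<close> labels in an alternating chain have absolute value at most \<open>k\<close>;
  the others come from edges.\<close>

lemma alternating_chain:
  assumes "k < n"
  obtains S T b where "T \<in> signed_sets n"
    "\<And>p. p < n - k \<Longrightarrow> S p \<in> signed_sets n \<and> S p \<subseteq> T \<and> k < alt_set n (S p)"
    "\<And>p. p < n - k \<Longrightarrow> dominant (S p) \<longleftrightarrow> even p \<noteq> b"
    "\<And>p. Suc p < n - k \<Longrightarrow> max_colour (S p) < max_colour (S (Suc p))"
proof -
  interpret antipodal_labelling "label k" n by (rule antipodal_labelling_label)
  obtain w where w: "w \<in> signed_perms n"
    and alt: "sorted_alternating True (chain_label (label k) w) [1..<Suc n]"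
    by (rule ky_fan)
  \<comment> \<open>Lists the members of the chain by increasing label, which need not be the order
    of inclusion.\<close>
  define js where "js = sort_key (chain_label (label k) w) [1..<Suc n]"
  define X where "X p = set (take (js ! p) w)" for p
  have len: "length js = n" by (simp add: js_def)
  have js: "js ! p \<in> {1..n}" if "p < n" for p
  proof -
    have "js ! p \<in> set js" using that len by simp
    also have "set js = {1..n}" by (auto simp: js_def)
    finally show ?thesis .
  qed
  have X: "X p \<in> signed_sets n" if "p < n" for p
    unfolding X_def using js[OF that] w by (intro prefix_in_signed_sets) auto
  have sign: "label_sign k (X p) \<longleftrightarrow> even p" if "p < n" for p
  proof -
    have "alternating_from True (map (odd \<circ> chain_label (label k) w) js)"
      using alt by (simp only: sorted_alternating_def js_def)
    then have "odd (label k (X p)) \<longleftrightarrow> even p"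
      using alternating_from_nth[of True "map (odd \<circ> chain_label (label k) w) js" p] that len
      by (simp add: X_def chain_label_def)
    then show ?thesis by (simp add: label_def)
  qed
  \<comment> \<open>Consecutive labels have different signs, so equal absolute values would make
    them opposite.\<close>
  have step: "label_value k (X p) < label_value k (X (Suc p))" if "Suc p < n" for p
  proof -
    have "sorted (map (chain_label (label k) w) js)" unfolding js_def by (rule sorted_sort_key)
    then have "label k (X p) \<le> label k (X (Suc p))"
      using that len sorted_nth_mono[of "map (chain_label (label k) w) js" p "Suc p"]
      by (simp add: X_def chain_label_def)
    then have "label_value k (X p) \<le> label_value k (X (Suc p))"
      by (cases "label_sign k (X p)"; cases "label_sign k (X (Suc p))") (simp_all add: label_def)
    moreover have "label k (X p) \<noteq> opposite (label k (X (Suc p)))"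
      unfolding X_def chain_label_def[symmetric] using js that
      by (intro chain_no_opposite[OF w]) auto
    then have "label_value k (X p) \<noteq> label_value k (X (Suc p))"
      unfolding label_eq_opposite_iff using sign[of p] sign[of "Suc p"] that by auto
    ultimately show ?thesis by simp
  qed
  \<comment> \<open>The absolute values are strictly increasing and start at 1 or more, so from
    position \<open>k\<close> on they exceed \<open>k\<close>.\<close>
  have value_ge: "p < n \<Longrightarrow> p < label_value k (X p)" for p
  proof (induction p)
    case 0
    then show ?case using label_value_pos X by blast
  next
    case (Suc p)
    then show ?case using step[of p] by simp
  qed
  have big: "k < alt_set n (X (k + p))" if "p < n - k" for p
    using value_ge[of "k + p"] label_value_le_iff[OF X, of "k + p"] that by linarith
  \<comment> \<open>The top of the chain serves as \<open>T\<close>: edges found in different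
    members can then be compared inside a single vector.\<close>
  have "set w \<in> signed_sets n"
    using prefix_in_signed_sets[OF w, of n n] length_signed_perms[OF w] assms by simp
  then show thesis
  \<comment> \<open>The first \<open>k\<close> labels are skipped; this shift reverses the sign
    pattern when \<open>k\<close> is odd.\<close>
  proof (rule that[where S = "\<lambda>p. X (k + p)" and b = "odd k"])
    fix p assume p: "p < n - k"
    have "X (k + p) \<subseteq> set w" unfolding X_def by (rule set_take_subset)
    then show "X (k + p) \<in> signed_sets n \<and> X (k + p) \<subseteq> set w \<and> k < alt_set n (X (k + p))"
      using X[of "k + p"] big[OF p] p by simp
    show "dominant (X (k + p)) \<longleftrightarrow> even p \<noteq> odd k"
      using sign[of "k + p"] big[OF p] p by (auto simp: label_sign_def)
  next
    fix p assume p: "Suc p < n - k"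
    then show "max_colour (X (k + p)) < max_colour (X (k + Suc p))"
      using step[of "k + p"] big[of p] big[of "Suc p"] by (simp add: label_value_def)
  qed
qed

text \<open>Each member of the chain contributes an edge of its largest colour, and opposite signs
  put these edges on different sides of \<open>T\<close>. The member \<open>S\<close> with the
  smallest of these colours is handed on because the strong alternation number gives it an edge on
  its other side as well.\<close>

lemma alternating_edges:
  assumes "k < n"
  obtains F S T b where "T \<in> signed_sets n" "S \<in> signed_sets n" "S \<subseteq> T" "k < alt_set n S"
    "max_colour S = c (F 0)"
    "\<And>p. p < n - k \<Longrightarrow> F p \<in> E \<and> F p \<subseteq> side (even p \<noteq> b) T"
    "\<And>p. Suc p < n - k \<Longrightarrow> c (F p) < c (F (Suc p))"
proof -
  obtain S T b where T: "T \<in> signed_sets n"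
    and S: "\<And>p. p < n - k \<Longrightarrow> S p \<in> signed_sets n \<and> S p \<subseteq> T \<and> k < alt_set n (S p)"
    and dom: "\<And>p. p < n - k \<Longrightarrow> dominant (S p) \<longleftrightarrow> even p \<noteq> b"
    and less: "\<And>p. Suc p < n - k \<Longrightarrow> max_colour (S p) < max_colour (S (Suc p))"
    using alternating_chain[OF assms] by metis
  have "\<exists>e. e \<in> E \<and> e \<subseteq> side (dominant (S p)) (S p) \<and> c e = max_colour (S p)"
    if "p < n - k" for p
    using dominant_edge[of "S p"] edge[of "S p"] S[OF that] by blast
  then obtain F where F: "\<And>p. p < n - k \<Longrightarrow> F p \<in> E \<and> F p \<subseteq> side (dominant (S p)) (S p) \<and>
      c (F p) = max_colour (S p)"
    by metis
  show thesis
  proof (rule that[of T "S 0" F b])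
    fix p assume p: "p < n - k"
    have "F p \<subseteq> side (even p \<noteq> b) (S p)" using F[OF p] unfolding dom[OF p] by blast
    then show "F p \<in> E \<and> F p \<subseteq> side (even p \<noteq> b) T"
      using F[OF p] S[OF p] side_mono by blast
  qed (use T S[of 0] F less assms in auto)
qed

end

end

section \<open>The bipartite subgraph of a sequence of edges with increasing colours\<close>

lemma card_even_less: "card {p. p < t \<and> even p} = (t + 1) div 2"
proof (induction t)
  case (Suc t)
  have "{p. p < Suc t \<and> even p} = (if even t then insert t {p. p < t \<and> even p} else {p. p < t \<and> even p})"
    by (auto simp: less_Suc_eq)
  with Suc show ?case by (cases "even t") auto
qed simp

lemma card_odd_less: "card {p. p < t \<and> odd p} = t div 2"
proof (induction t)
  case (Suc t)
  have "{p. p < Suc t \<and> odd p} = (if odd t then insert t {p. p < t \<and> odd p} else {p. p < t \<and> odd p})"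
    by (auto simp: less_Suc_eq)
  with Suc show ?case by (cases "even t") auto
qed simp

lemma wf_digraph_KG: "wf_digraph (with_proj (KG E))"
  by unfold_locales (auto simp: KG_def)

text \<open>Colours increase along the sequence, so the parity of a position decides both the part
  of the edge and the parity of the rank of its colour.\<close>

lemma colourful_bipartite_of_edges:
  fixes E :: "'a set set" and c :: "'a set \<Rightarrow> nat" and G :: "nat \<Rightarrow> 'a set"
  assumes edges: "\<And>p. p < t \<Longrightarrow> G p \<in> E"
    and less: "\<And>p. Suc p < t \<Longrightarrow> c (G p) < c (G (Suc p))"
    and disjoint: "\<And>p q. p < t \<Longrightarrow> q < t \<Longrightarrow> even p \<Longrightarrow> odd q \<Longrightarrow> G p \<inter> G q = {}"
  shows "\<exists>(K :: 'a set pair_pre_digraph) A B.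
           subgraph (with_proj K) (with_proj (KG E)) \<and>
           complete_bipartite_parts (t div 2) ((t + 1) div 2) A B (with_proj K) \<and>
           inj_on c (A \<union> B) \<and>
           (\<exists>i :: nat \<Rightarrow> nat. strict_mono_on {1..t} i \<and> i ` {1..t} = c ` (A \<union> B) \<and>
              (c ` A = i ` {j \<in> {1..t}. odd j} \<and> c ` B = i ` {j \<in> {1..t}. even j} \<or>
               c ` A = i ` {j \<in> {1..t}. even j} \<and> c ` B = i ` {j \<in> {1..t}. odd j}))"
proof -
  \<comment> \<open>Positions start at 0: the odd ones, \<open>t div 2\<close> in number, carry the
    colours of even rank.\<close>
  define A where "A = G ` {p. p < t \<and> odd p}"
  define B where "B = G ` {p. p < t \<and> even p}"
  define K :: "'a set pair_pre_digraph" where "K = \<lparr> pverts = A \<union> B, parcs = A \<times> B \<union> B \<times> A \<rparr>"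
  define i where "i j = c (G (j - 1))" for j :: nat
  have mono: "c (G p) < c (G q)" if "p < q" "q < t" for p q
    using that
  proof (induction q)
    case (Suc q)
    then show ?case using less[of q] by (cases "p = q") auto
  qed simp
  have inj_cG: "inj_on (\<lambda>p. c (G p)) {p. p < t}"
    by (rule inj_onI) (metis mem_Collect_eq mono less_irrefl linorder_neqE_nat)
  then have inj_G: "inj_on G {p. p < t}" by (auto simp: inj_on_def)
  have AB: "A \<union> B = G ` {p. p < t}" unfolding A_def B_def by blast
  have inj_c: "inj_on c (A \<union> B)" unfolding AB using inj_cG by (auto simp: inj_on_def)
  have "A \<inter> B = {}"
  proof (rule equals0I)
    fix e assume "e \<in> A \<inter> B"
    then obtain p q where "e = G p" "p < t" "odd p" "e = G q" "q < t" "even q"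
      unfolding A_def B_def by blast
    then show False using inj_onD[OF inj_G, of p q] by auto
  qed
  moreover have "card A = t div 2"
    unfolding A_def using inj_G card_odd_less[of t]
    by (subst card_image) (auto intro: inj_on_subset)
  moreover have "card B = (t + 1) div 2"
    unfolding B_def using inj_G card_even_less[of t]
    by (subst card_image) (auto intro: inj_on_subset)
  moreover have fin: "finite (A \<union> B)" unfolding AB by simp
  moreover have "complete_bipartite_digraph (t div 2) ((t + 1) div 2) (with_proj K)"
    unfolding complete_bipartite_digraph_pair_def
    by (intro conjI exI[of _ A] exI[of _ B]) (use calculation in \<open>simp_all add: K_def\<close>)
  then have "graph (with_proj K)" by (simp add: complete_bipartite_digraph_def)
  ultimately have parts: "complete_bipartite_parts (t div 2) ((t + 1) div 2) A B (with_proj K)"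
    by (simp add: complete_bipartite_parts_def K_def)
  have "A \<union> B \<subseteq> E" unfolding AB using edges by blast
  moreover have "e \<inter> f = {}" if "e \<in> B" "f \<in> A" for e f
    using that disjoint unfolding A_def B_def by blast
  then have "A \<times> B \<union> B \<times> A \<subseteq> {(e, f). e \<inter> f = {}}" by blast
  moreover have "wf_digraph (with_proj K)" by unfold_locales (auto simp: K_def)
  ultimately have sub: "subgraph (with_proj K) (with_proj (KG E))"
    using wf_digraph_KG[of E] by (auto simp: subgraph_def K_def KG_def)
  have "strict_mono_on {1..t} i"
    unfolding i_def by (rule strict_mono_onI) (auto intro!: mono)
  moreover have image: "i ` {j \<in> {1..t}. P j} = c ` G ` {p. p < t \<and> P (Suc p)}" for P
  proof -
    have "{j \<in> {1..t}. P j} = Suc ` {p. p < t \<and> P (Suc p)}"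
    proof (intro set_eqI iffI)
      fix j assume "j \<in> {j \<in> {1..t}. P j}"
      then have "j = Suc (j - 1)" "j - 1 \<in> {p. p < t \<and> P (Suc p)}" by auto
      then show "j \<in> Suc ` {p. p < t \<and> P (Suc p)}" by (rule image_eqI)
    qed auto
    then show ?thesis by (simp add: i_def image_image)
  qed
  have "i ` {1..t} = c ` (A \<union> B)" unfolding AB using image[of "\<lambda>_. True"] by (simp only: Collect_mem_eq simp_thms)
  moreover have "c ` A = i ` {j \<in> {1..t}. even j}" "c ` B = i ` {j \<in> {1..t}. odd j}"
    unfolding image A_def B_def by simp_all
  ultimately show ?thesis using sub parts inj_c by blast
qed

section \<open>Edges forced by a large alternation number\<close>

lemma contains_edge_of_alt_ord_less:
  assumes "X \<in> sign_vectors (card V)" "alt_ord V E \<sigma> < alt_vec X"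
  shows "contains_edge E (\<sigma> ` pos X) \<or> contains_edge E (\<sigma> ` neg X)"
proof (rule ccontr)
  let ?S = "{X \<in> sign_vectors (card V). \<not> contains_edge E (\<sigma> ` pos X) \<and> \<not> contains_edge E (\<sigma> ` neg X)}"
  assume "\<not> ?thesis"
  then have "alt_vec X \<in> alt_vec ` ?S" using assms(1) by blast
  moreover have "finite ?S" using finite_sign_vectors by (rule finite_subset[rotated]) blast
  ultimately have "alt_vec X \<le> alt_ord V E \<sigma>" unfolding alt_ord_def by (intro Max_ge) auto
  with assms(2) show False by simp
qed

text \<open>A vector above the maximum violates the disjunction in \<open>salt_ord\<close>, hence
  both of its disjuncts.\<close>

lemma contains_edge_of_salt_ord_less:
  assumes "X \<in> sign_vectors (card V)" "salt_ord V E \<sigma> < alt_vec X"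
  shows "contains_edge E (\<sigma> ` pos X) \<and> contains_edge E (\<sigma> ` neg X)"
proof (rule ccontr)
  let ?S = "{X \<in> sign_vectors (card V). \<not> contains_edge E (\<sigma> ` pos X) \<or> \<not> contains_edge E (\<sigma> ` neg X)}"
  assume "\<not> ?thesis"
  then have "alt_vec X \<in> alt_vec ` ?S" using assms(1) by blast
  moreover have "finite ?S" using finite_sign_vectors by (rule finite_subset[rotated]) blast
  ultimately have "alt_vec X \<le> salt_ord V E \<sigma>" unfolding salt_ord_def by (intro Max_ge) auto
  with assms(2) show False by simp
qed

lemma alt_attained:
  assumes "finite V" "{} \<notin> E"
  obtains \<sigma> where "\<sigma> \<in> orderings V" "alt_ord V E \<sigma> = alt V E"
proof -
  have "alt V E \<in> alt_ord V E ` orderings V"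
    unfolding alt_def using assms by (intro Min_in finite_alt_ord_image) (auto simp: orderings_nonempty)
  then show thesis using that by auto
qed

lemma salt_attained:
  assumes "finite V" "{} \<notin> E"
  obtains \<sigma> where "\<sigma> \<in> orderings V" "salt_ord V E \<sigma> = salt V E"
proof -
  have "salt V E \<in> salt_ord V E ` orderings V"
    unfolding salt_def using assms by (intro Min_in finite_salt_ord_image) (auto simp: orderings_nonempty)
  then show thesis using that by auto
qed

lemma (in coloured_kneser) contains_edge_side:
  assumes "S \<in> signed_sets n"
  shows "contains_edge E (\<sigma> ` pos (sign_vector n S)) \<longleftrightarrow> (\<exists>e\<in>E. e \<subseteq> side True S)"
    and "contains_edge E (\<sigma> ` neg (sign_vector n S)) \<longleftrightarrow> (\<exists>e\<in>E. e \<subseteq> side False S)"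
  by (simp_all add: contains_edge_def side_def pos_sign_vector[OF assms] neg_sign_vector[OF assms])

lemma coloured_kneserI:
  assumes "hypergraph V E" "proper_coloring (with_proj (KG E)) c {1..C}" "\<sigma> \<in> orderings V"
  shows "coloured_kneser E c (card V) \<sigma>"
proof
  show "finite E"
    using assms(1) finite_subset[of E "Pow V"] by (auto simp: hypergraph_def)
  show "c e \<noteq> c f" if "e \<in> E" "f \<in> E" "e \<inter> f = {}" for e f
    using assms(2) that by (auto simp: proper_coloring_def KG_def)
  show "0 < c e" if "e \<in> E" for e
    using assms(2) that by (force simp: proper_coloring_def KG_def)
  show "inj_on \<sigma> {..<card V}"
    using assms(3) by (auto simp: orderings_def bij_betw_def)
qed

theorem theorem1:
  fixes V :: "'a set" and E :: "'a set set" and c :: "'a set \<Rightarrow> nat" and C n t :: nat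
  assumes "hypergraph V E"
    and "E \<noteq> {}"
    and "n = card V"
    and "t = max (n - alt V E) (n - salt V E + 1)"
    and "proper_coloring (with_proj (KG E)) c {1..C}"
  shows "\<exists>(K :: 'a set pair_pre_digraph) A B.
           subgraph (with_proj K) (with_proj (KG E)) \<and>
           complete_bipartite_parts (t div 2) ((t + 1) div 2) A B (with_proj K) \<and>
           inj_on c (A \<union> B) \<and>
           (\<exists>i :: nat \<Rightarrow> nat. strict_mono_on {1..t} i \<and> i ` {1..t} = c ` (A \<union> B) \<and>
              (c ` A = i ` {j \<in> {1..t}. odd j} \<and> c ` B = i ` {j \<in> {1..t}. even j} \<or>
               c ` A = i ` {j \<in> {1..t}. even j} \<and> c ` B = i ` {j \<in> {1..t}. odd j}))"
proof -
  have "finite V" using assms(1) by (simp add: hypergraph_def)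
  \<comment> \<open>An empty edge would be disjoint from itself, a loop that no proper colouring
    allows.\<close>
  have "{} \<notin> E" using assms(5) by (auto simp: proper_coloring_def KG_def)
  have "\<exists>G. (\<forall>p<t. G p \<in> E) \<and> (\<forall>p. Suc p < t \<longrightarrow> c (G p) < c (G (Suc p))) \<and>
      (\<forall>p q. p < t \<longrightarrow> q < t \<longrightarrow> even p \<longrightarrow> odd q \<longrightarrow> G p \<inter> G q = {})"
  proof -
    \<comment> \<open>The second term makes \<open>t\<close> at least 1, so besides the two cases
      with a positive difference there remains \<open>n - salt V E = 0\<close> with the second term
      attaining the maximum. Then any single edge forms \<open>K_{0,1}\<close>.\<close>
    consider "t = 1" | "alt V E < n" "t = n - alt V E" | "salt V E < n" "t = Suc (n - salt V E)"
      using assms(4) by linarith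
    then show ?thesis
    proof cases
      case 1
      obtain e where "e \<in> E" using assms(2) by blast
      with 1 show ?thesis by (intro exI[of _ "\<lambda>_. e"]) auto
    next
      case 2
      obtain \<sigma> where \<sigma>: "\<sigma> \<in> orderings V" "alt_ord V E \<sigma> = alt V E"
        using alt_attained[OF \<open>finite V\<close> \<open>{} \<notin> E\<close>] .
      interpret coloured_kneser E c n \<sigma>
        unfolding assms(3) by (rule coloured_kneserI[OF assms(1,5) \<sigma>(1)])
      have edge: "\<exists>e\<in>E. \<exists>b. e \<subseteq> side b S" if "S \<in> signed_sets n" "alt V E < alt_set n S" for S
        using contains_edge_of_alt_ord_less[of "sign_vector n S" V E \<sigma>] that \<sigma>(2)
          sign_vector_in_sign_vectors[of n S] assms(3)
        unfolding contains_edge_side[OF that(1)] by auto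
      obtain F S T b where T: "T \<in> signed_sets n"
        and F: "\<And>p. p < n - alt V E \<Longrightarrow> F p \<in> E \<and> F p \<subseteq> side (even p \<noteq> b) T"
        and less: "\<And>p. Suc p < n - alt V E \<Longrightarrow> c (F p) < c (F (Suc p))"
        using alternating_edges[OF edge 2(1)] by metis
      have "F p \<inter> F q = {}" if "p < t" "q < t" "even p" "odd q" for p q
        using F[of p] F[of q] sides_disjoint[OF T, of "even p \<noteq> b" "even q \<noteq> b"] that 2(2) by auto
      then show ?thesis using F less 2(2) by (intro exI[of _ F]) auto
    next
      case 3
      obtain \<sigma> where \<sigma>: "\<sigma> \<in> orderings V" "salt_ord V E \<sigma> = salt V E"
        using salt_attained[OF \<open>finite V\<close> \<open>{} \<notin> E\<close>] .
      interpret coloured_kneser E c n \<sigma>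
        unfolding assms(3) by (rule coloured_kneserI[OF assms(1,5) \<sigma>(1)])
      have edge: "\<exists>e\<in>E. e \<subseteq> side b S" if "S \<in> signed_sets n" "salt V E < alt_set n S" for S b
        using contains_edge_of_salt_ord_less[of "sign_vector n S" V E \<sigma>] that \<sigma>(2)
          sign_vector_in_sign_vectors[of n S] assms(3)
        unfolding contains_edge_side[OF that(1)] by (cases b) auto
      then have edge': "\<exists>e\<in>E. \<exists>b. e \<subseteq> side b S" if "S \<in> signed_sets n" "salt V E < alt_set n S" for S
        using that by blast
      obtain F S T b where T: "T \<in> signed_sets n"
        and S: "S \<in> signed_sets n" "S \<subseteq> T" "salt V E < alt_set n S" "max_colour S = c (F 0)"
        and F: "\<And>p. p < n - salt V E \<Longrightarrow> F p \<in> E \<and> F p \<subseteq> side (even p \<noteq> b) T"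
        and less: "\<And>p. Suc p < n - salt V E \<Longrightarrow> c (F p) < c (F (Suc p))"
        using alternating_edges[OF edge' 3(1)] by metis
      \<comment> \<open>The edge \<open>F 0\<close> lies on side \<open>\<not> b\<close> of
        \<open>T\<close>, and the other side of \<open>S\<close> supplies \<open>e\<close>. The
        colour of \<open>e\<close> differs from that of \<open>F 0\<close> by properness and is not
        larger because \<open>c (F 0)\<close> is the largest colour in \<open>S\<close>.\<close>
      obtain e where e: "e \<in> E" "e \<subseteq> side b S" using edge[OF S(1,3)] by blast
      then have "e \<subseteq> side b T" using side_mono[OF S(2)] by blast
      have F0: "F 0 \<in> E" "F 0 \<subseteq> side (\<not> b) T" using F[of 0] 3(1) by auto
      have "c e \<noteq> c (F 0)"
        using proper[OF e(1) F0(1)] sides_disjoint[OF T, of b "\<not> b"] F0(2) \<open>e \<subseteq> side b T\<close> by blast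
      then have "c e < c (F 0)" using colour_le_max[OF e] S(4) by simp
      \<comment> \<open>Prepending \<open>e\<close> shifts the positions by one, so
        \<open>even p = b\<close> replaces \<open>even p \<noteq> b\<close>.\<close>
      define G where "G p = (case p of 0 \<Rightarrow> e | Suc q \<Rightarrow> F q)" for p
      have G: "G p \<in> E \<and> G p \<subseteq> side (even p = b) T" if "p < t" for p
      proof (cases p)
        case 0
        then show ?thesis using e(1) \<open>e \<subseteq> side b T\<close> by (simp add: G_def)
      next
        case (Suc q)
        then have "(even p = b) = (even q \<noteq> b)" by auto
        then show ?thesis using F[of q] that Suc 3(2) by (simp add: G_def)
      qed
      have "G p \<inter> G q = {}" if "p < t" "q < t" "even p" "odd q" for p q
        using G[of p] G[of q] sides_disjoint[OF T, of "even p = b" "even q = b"] that by auto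
      moreover have "c (G p) < c (G (Suc p))" if "Suc p < t" for p
        using that less \<open>c e < c (F 0)\<close> 3(2) by (cases p) (auto simp: G_def)
      ultimately show ?thesis using G by blast
    qed
  qed
  then obtain G where "\<And>p. p < t \<Longrightarrow> G p \<in> E" "\<And>p. Suc p < t \<Longrightarrow> c (G p) < c (G (Suc p))"
    "\<And>p q. p < t \<Longrightarrow> q < t \<Longrightarrow> even p \<Longrightarrow> odd q \<Longrightarrow> G p \<inter> G q = {}"
    by blast
  then show ?thesis by (rule colourful_bipartite_of_edges)
qed

end
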